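(* Let $\Gamma=(\mathcal{C},\mathcal{G},\Omega)$ be a complete width category and let $X\in\mathcal{C}$. Then the $\Gamma$-width and the chordal $\Gamma$-width of $X$ agree: $$\mathbf{w}_\Gamma(X)=\mathbf{cw}_\Gamma(X).$$
   Context: Graphs: a graph $G$ is a finite vertex set $V(G)$ with a symmetric irreflexive relation $E(G)\subseteq V(G)^2$; $\bullet$ is the one-vertex graph. The category $\int G$ has as objects the vertices of $G$ and the (unordered) edges of $G$; its only non-identity morphisms are, for each edge $e=xy$, two morphisms $e_x:e\to x$ and $e_y:e\to y$. (Index graphs may also be multigraphs, in which case $\int G$ has one span $x\leftarrow e\to y$ for each edge $e$, with two distinct legs even if $e$ is a loop.) Structured decompositions: a structured decomposition of shape $G$ in a category $\mathcal{C}$ is a functor $d:\int G\to\mathcal{C}$ sending every morphism to a monomorphism; the $d(v)$, $v\in V(G)$, are its bags and the $d(e)$, $e$ an edge, its adhesions. It is a structured decomposition of an object $X$ if $X\cong\operatorname{colim} d$. For a set $\mathcal{G}$ of graphs, a $\mathcal{G}$-structured decomposition is one whose shape is in $\mathcal{G}$. sd-category: a pair $(\mathcal{C},\mathcal{G})$ of a small category $\mathcal{C}$ and a set $\mathcal{G}$ of graphs with $\bullet\in\mathcal{G}$ such that (W1) every $\mathcal{G}$-structured decomposition in $\mathcal{C}$ has a colimit in $\mathcal{C}$. Spined sd-category: a triple $(\mathcal{C},\mathcal{G},\Omega)$, where $(\mathcal{C},\mathcal{G})$ is an sd-category and $\Omega=\bigcup_{n\ge0}\Omega_n$ is a full subcategory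 closed under isomorphism, filtered by full subcategories $\Omega_0\subseteq\Omega_1\subseteq\cdots$ closed under isomorphism, such that (W2a) every object $X$ admits a monomorphism $X\hookrightarrow W$ with $W\in\Omega$; (W2b) for $n\ge1$ and $W\in\Omega_n\setminus\Omega_{n-1}$ there is no monomorphism from $W$ into any object of $\Omega_{n-1}$. Objects of $\Omega$ are called complete. Width category: a spined sd-category that is monic-stable, i.e. pullbacks of monomorphisms along arbitrary morphisms exist in $\mathcal{C}$ and (W3) for every $\mathcal{G}$-structured decomposition $d$ of an object $Y$ with colimit cocone $(d(i)\to Y)_i$ and every monomorphism $f:X\to Y$, the pullback of this cocone along $f$ (with objects $X\times_Y d(i)$ and maps to $X$ the projections) exists and is a colimit cocone with apex $X$. Complete width category: a completion of a $\mathcal{G}$-structured decomposition $d:\int G\to\mathcal{C}$ is a natural transformation $\alpha:d\Rightarrow d'$ to a diagram $d':\int G\to\mathcal{C}$ such that every bag $d'(x)$ is complete, every component $\alpha_e:d(e)\to d'(e)$ at an edge object is an identity, and every component $\alpha_x:d(x)\to d'(x)$ at a vertex object is a monomorphism. A width category is complete if (W4) for every completion $\alpha:d\Rightarrow d'$ of a $\mathcal{G}$-structured decomposition $d$ the induced map $\operatorname{colim} d\to\operatorname{colim} d'$ is a monomorphism. Size and width: $s(X)$ is the smallest $n$ such that there is a monomorphism $X\hookrightarrow W$ with $W\in\Omega_n$. The width of $d:\int G\to\mathcal{C}$ is $w(d)=\max_{x\in V(G)}s(d(x))-1$ (the maximum over the empty set being read as $0$). $\mathbf{w}_\Gamma(X)=\min_d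 w(d)$ over all $\mathcal{G}$-structured decompositions $d$ of $X$. Chordal width: a $(\mathcal{G},\Omega)$-structured decomposition is a $\mathcal{G}$-structured decomposition all of whose bags lie in $\Omega$; its $(\mathcal{G},\Omega)$-width is $n-1$, where $n$ is the smallest integer $\geq 0$ such that all its bags lie in $\Omega_n$. An object $Y$ is chordal if it is the colimit of a $(\mathcal{G},\Omega)$-structured decomposition; its $(\mathcal{G},\Omega)$-width is the minimum of the $(\mathcal{G},\Omega)$-widths of all $(\mathcal{G},\Omega)$-structured decompositions of $Y$. A chordal completion of $X$ is a monomorphism $X\hookrightarrow Y$ with $Y$ chordal. The chordal $\Gamma$-width $\mathbf{cw}_\Gamma(X)$ is the minimum of the $(\mathcal{G},\Omega)$-widths of $Y$ over all chordal completions $X\hookrightarrow Y$. *)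

theory Defs
  imports Main
begin

section \<open>Categories\<close>

text \<open>
  Composition is a total function, but it is only meaningful for composable arrows.  Smallness is
  automatic, as objects and arrows form sets.
\<close>

record ('o, 'a) cat =
  Obj :: "'o set"
  Arr :: "'a set"
  Dom :: "'a \<Rightarrow> 'o"
  Cod :: "'a \<Rightarrow> 'o"
  Id :: "'o \<Rightarrow> 'a"
  Comp :: "'a \<Rightarrow> 'a \<Rightarrow> 'a" (infixr \<open>\<odot>\<index>\<close> 70)

locale category =
  fixes C :: "('o, 'a) cat" (structure)
  assumes Dom_in: "f \<in> Arr C \<Longrightarrow> Dom C f \<in> Obj C"
    and Cod_in: "f \<in> Arr C \<Longrightarrow> Cod C f \<in> Obj C"
    and Id_in: "x \<in> Obj C \<Longrightarrow> Id C x \<in> Arr C"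
    and Dom_Id: "x \<in> Obj C \<Longrightarrow> Dom C (Id C x) = x"
    and Cod_Id: "x \<in> Obj C \<Longrightarrow> Cod C (Id C x) = x"
    and Comp_in: "\<lbrakk>f \<in> Arr C; g \<in> Arr C; Cod C f = Dom C g\<rbrakk> \<Longrightarrow> g \<odot> f \<in> Arr C"
    and Dom_Comp: "\<lbrakk>f \<in> Arr C; g \<in> Arr C; Cod C f = Dom C g\<rbrakk> \<Longrightarrow> Dom C (g \<odot> f) = Dom C f"
    and Cod_Comp: "\<lbrakk>f \<in> Arr C; g \<in> Arr C; Cod C f = Dom C g\<rbrakk> \<Longrightarrow> Cod C (g \<odot> f) = Cod C g"
    and Comp_Id: "f \<in> Arr C \<Longrightarrow> f \<odot> Id C (Dom C f) = f"
    and Id_Comp: "f \<in> Arr C \<Longrightarrow> Id C (Cod C f) \<odot> f = f"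
    and Comp_assoc:
      "\<lbrakk>f \<in> Arr C; g \<in> Arr C; h \<in> Arr C; Cod C f = Dom C g; Cod C g = Dom C h\<rbrakk>
        \<Longrightarrow> (h \<odot> g) \<odot> f = h \<odot> (g \<odot> f)"

definition hom :: "('o, 'a) cat \<Rightarrow> 'o \<Rightarrow> 'o \<Rightarrow> 'a set" where
  "hom C x y = {f \<in> Arr C. Dom C f = x \<and> Cod C f = y}"

definition monic :: "('o, 'a) cat \<Rightarrow> 'a \<Rightarrow> bool" where
  "monic C f \<longleftrightarrow> f \<in> Arr C \<and>
     (\<forall>w \<in> Obj C. \<forall>g \<in> hom C w (Dom C f). \<forall>h \<in> hom C w (Dom C f).
        f \<odot>\<^bsub>C\<^esub> g = f \<odot>\<^bsub>C\<^esub> h \<longrightarrow> g = h)"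

definition mono_hom :: "('o, 'a) cat \<Rightarrow> 'o \<Rightarrow> 'o \<Rightarrow> 'a set" where
  "mono_hom C x y = {f \<in> hom C x y. monic C f}"

definition isomorphic :: "('o, 'a) cat \<Rightarrow> 'o \<Rightarrow> 'o \<Rightarrow> bool" where
  "isomorphic C x y \<longleftrightarrow> x \<in> Obj C \<and> y \<in> Obj C \<and>
     (\<exists>f \<in> hom C x y. \<exists>g \<in> hom C y x. g \<odot>\<^bsub>C\<^esub> f = Id C x \<and> f \<odot>\<^bsub>C\<^esub> g = Id C y)"

record ('i, 'j, 'o, 'a) fctr =
  ob :: "'i \<Rightarrow> 'o"
  ar :: "'j \<Rightarrow> 'a"

definition is_functor :: "('i, 'j) cat \<Rightarrow> ('o, 'a) cat \<Rightarrow> ('i, 'j, 'o, 'a) fctr \<Rightarrow> bool" where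
  "is_functor J C d \<longleftrightarrow>
     (\<forall>i \<in> Obj J. ob d i \<in> Obj C) \<and>
     (\<forall>u \<in> Arr J. ar d u \<in> hom C (ob d (Dom J u)) (ob d (Cod J u))) \<and>
     (\<forall>i \<in> Obj J. ar d (Id J i) = Id C (ob d i)) \<and>
     (\<forall>u \<in> Arr J. \<forall>v \<in> Arr J. Cod J u = Dom J v \<longrightarrow>
        ar d (v \<odot>\<^bsub>J\<^esub> u) = ar d v \<odot>\<^bsub>C\<^esub> ar d u)"

definition is_nat_trans ::
  "('i, 'j) cat \<Rightarrow> ('o, 'a) cat \<Rightarrow> ('i, 'j, 'o, 'a) fctr \<Rightarrow> ('i, 'j, 'o, 'a) fctr
    \<Rightarrow> ('i \<Rightarrow> 'a) \<Rightarrow> bool" where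
  "is_nat_trans J C d d' \<alpha> \<longleftrightarrow>
     (\<forall>i \<in> Obj J. \<alpha> i \<in> hom C (ob d i) (ob d' i)) \<and>
     (\<forall>u \<in> Arr J. ar d' u \<odot>\<^bsub>C\<^esub> \<alpha> (Dom J u) = \<alpha> (Cod J u) \<odot>\<^bsub>C\<^esub> ar d u)"

definition is_cocone ::
  "('i, 'j) cat \<Rightarrow> ('o, 'a) cat \<Rightarrow> ('i, 'j, 'o, 'a) fctr \<Rightarrow> 'o \<Rightarrow> ('i \<Rightarrow> 'a) \<Rightarrow> bool" where
  "is_cocone J C d x c \<longleftrightarrow> x \<in> Obj C \<and>
     (\<forall>i \<in> Obj J. c i \<in> hom C (ob d i) x) \<and>
     (\<forall>u \<in> Arr J. c (Cod J u) \<odot>\<^bsub>C\<^esub> ar d u = c (Dom J u))"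

definition is_colimit ::
  "('i, 'j) cat \<Rightarrow> ('o, 'a) cat \<Rightarrow> ('i, 'j, 'o, 'a) fctr \<Rightarrow> 'o \<Rightarrow> ('i \<Rightarrow> 'a) \<Rightarrow> bool" where
  "is_colimit J C d x c \<longleftrightarrow> is_cocone J C d x c \<and>
     (\<forall>y k. is_cocone J C d y k \<longrightarrow>
        (\<exists>!m. m \<in> hom C x y \<and> (\<forall>i \<in> Obj J. m \<odot>\<^bsub>C\<^esub> c i = k i)))"

definition is_pullback ::
  "('o, 'a) cat \<Rightarrow> 'a \<Rightarrow> 'a \<Rightarrow> 'o \<Rightarrow> 'a \<Rightarrow> 'a \<Rightarrow> bool" where
  "is_pullback C f g P p q \<longleftrightarrow>
     f \<in> Arr C \<and> g \<in> Arr C \<and> Cod C f = Cod C g \<and>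
     p \<in> hom C P (Dom C f) \<and> q \<in> hom C P (Dom C g) \<and> f \<odot>\<^bsub>C\<^esub> p = g \<odot>\<^bsub>C\<^esub> q \<and>
     (\<forall>Q \<in> Obj C. \<forall>a \<in> hom C Q (Dom C f). \<forall>b \<in> hom C Q (Dom C g).
        f \<odot>\<^bsub>C\<^esub> a = g \<odot>\<^bsub>C\<^esub> b \<longrightarrow>
        (\<exists>!m. m \<in> hom C Q P \<and> p \<odot>\<^bsub>C\<^esub> m = a \<and> q \<odot>\<^bsub>C\<^esub> m = b))"

text \<open>
  The diagram \<open>d'\<close> with cocone \<open>c'\<close> over the domain of \<open>f\<close> is a pullback along \<open>f\<close> of the
  cocone \<open>c\<close> over the codomain of \<open>f\<close>; the \<open>\<pi> i\<close> are the second projections.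
\<close>

definition is_pullback_cocone ::
  "('i, 'j) cat \<Rightarrow> ('o, 'a) cat \<Rightarrow> ('i, 'j, 'o, 'a) fctr \<Rightarrow> ('i \<Rightarrow> 'a) \<Rightarrow> 'a
    \<Rightarrow> ('i, 'j, 'o, 'a) fctr \<Rightarrow> ('i \<Rightarrow> 'a) \<Rightarrow> ('i \<Rightarrow> 'a) \<Rightarrow> bool" where
  "is_pullback_cocone J C d c f d' c' \<pi> \<longleftrightarrow>
     is_functor J C d' \<and> is_cocone J C d' (Dom C f) c' \<and> is_nat_trans J C d' d \<pi> \<and>
     (\<forall>i \<in> Obj J. is_pullback C f (c i) (ob d' i) (c' i) (\<pi> i))"


section \<open>Index graphs\<close>

text \<open>
  Index graphs are finite undirected multigraphs, possibly with loops.  To keep the two ends of a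
  loop apart, incidence is recorded by legs: every edge has exactly two legs, each attached to a
  vertex.
\<close>

record ('v, 'e, 'l) mgraph =
  verts :: "'v set"
  edges :: "'e set"
  legs :: "'l set"
  leg_edge :: "'l \<Rightarrow> 'e"
  leg_vert :: "'l \<Rightarrow> 'v"

definition multigraph :: "('v, 'e, 'l) mgraph \<Rightarrow> bool" where
  "multigraph G \<longleftrightarrow> finite (verts G) \<and> finite (edges G) \<and>
     (\<forall>l \<in> legs G. leg_edge G l \<in> edges G \<and> leg_vert G l \<in> verts G) \<and>
     (\<forall>e \<in> edges G. card {l \<in> legs G. leg_edge G l = e} = 2)"

text \<open>
  A simple graph is a finite set \<open>V\<close> with a symmetric irreflexive relation \<open>E\<close> on it.  The pair
  \<open>(x, y)\<close> serves as the leg of the edge \<open>{x, y}\<close> at \<open>x\<close>.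
\<close>

definition simple_graph :: "'v set \<Rightarrow> ('v \<times> 'v) set \<Rightarrow> ('v, 'v set, 'v \<times> 'v) mgraph" where
  "simple_graph V E =
     \<lparr>verts = V, edges = {{x, y} | x y. (x, y) \<in> E}, legs = E,
      leg_edge = (\<lambda>(x, y). {x, y}), leg_vert = fst\<rparr>"

lemma multigraph_simple_graph:
  assumes "finite V" and "E \<subseteq> V \<times> V" and "sym E" and "irrefl E"
  shows "multigraph (simple_graph V E)"
proof -
  have "finite E"
    using assms(1,2) by (meson finite_SigmaI finite_subset)
  moreover have "{{x, y} | x y. (x, y) \<in> E} = (\<lambda>(x, y). {x, y}) ` E"
    by auto
  ultimately have fin: "finite {{x, y} | x y. (x, y) \<in> E}"
    by simp
  have "card {l \<in> E. (\<lambda>(x, y). {x, y}) l = {x, y}} = 2" if xy: "(x, y) \<in> E" for x y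
  proof -
    have ne: "x \<noteq> y"
      using xy assms(4) by (auto simp: irrefl_def)
    have "{l \<in> E. (\<lambda>(x, y). {x, y}) l = {x, y}} = {(x, y), (y, x)}"
      using xy assms(3) by (auto simp: sym_def doubleton_eq_iff)
    then show ?thesis
      using ne by simp
  qed
  then show ?thesis
    using assms(1,2) fin by (auto simp: multigraph_def simple_graph_def)
qed

text \<open>
  The category \<open>\<integral>G\<close>: a leg starts at an edge and ends at a vertex, so in every composable pair of
  arrows at least one is an identity.
\<close>

datatype ('v, 'e) iobj = Vertex 'v | Edge 'e

datatype ('v, 'e, 'l) iarr = Ident "('v, 'e) iobj" | Leg 'l

definition int_cat :: "('v, 'e, 'l) mgraph \<Rightarrow> (('v, 'e) iobj, ('v, 'e, 'l) iarr) cat" where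
  "int_cat G =
     \<lparr>Obj = Vertex ` verts G \<union> Edge ` edges G,
      Arr = Ident ` (Vertex ` verts G \<union> Edge ` edges G) \<union> Leg ` legs G,
      Dom = (\<lambda>u. case u of Ident i \<Rightarrow> i | Leg l \<Rightarrow> Edge (leg_edge G l)),
      Cod = (\<lambda>u. case u of Ident i \<Rightarrow> i | Leg l \<Rightarrow> Vertex (leg_vert G l)),
      Id = Ident,
      Comp = (\<lambda>v u. case v of Ident i \<Rightarrow> u | Leg l \<Rightarrow> v)\<rparr>"

lemma category_int_cat: "multigraph G \<Longrightarrow> category (int_cat G)"
  by unfold_locales (auto simp: int_cat_def multigraph_def split: iarr.splits)


section \<open>Structured decompositions\<close>

type_synonym ('v, 'e, 'l, 'o, 'a) decomp =
  "(('v, 'e) iobj, ('v, 'e, 'l) iarr, 'o, 'a) fctr"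

definition structured_decomposition ::
  "('o, 'a) cat \<Rightarrow> ('v, 'e, 'l) mgraph \<Rightarrow> ('v, 'e, 'l, 'o, 'a) decomp \<Rightarrow> bool" where
  "structured_decomposition C G d \<longleftrightarrow>
     is_functor (int_cat G) C d \<and> (\<forall>u \<in> Arr (int_cat G). monic C (ar d u))"

definition decomposition_of ::
  "('o, 'a) cat \<Rightarrow> ('v, 'e, 'l) mgraph \<Rightarrow> ('v, 'e, 'l, 'o, 'a) decomp \<Rightarrow> 'o \<Rightarrow> bool" where
  "decomposition_of C G d x \<longleftrightarrow> structured_decomposition C G d \<and>
     (\<exists>y c. is_colimit (int_cat G) C d y c \<and> isomorphic C x y)"

definition is_completion ::
  "('o, 'a) cat \<Rightarrow> ('v, 'e, 'l) mgraph \<Rightarrow> (nat \<Rightarrow> 'o set)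
    \<Rightarrow> ('v, 'e, 'l, 'o, 'a) decomp \<Rightarrow> ('v, 'e, 'l, 'o, 'a) decomp
    \<Rightarrow> (('v, 'e) iobj \<Rightarrow> 'a) \<Rightarrow> bool" where
  "is_completion C G \<Omega> d d' \<alpha> \<longleftrightarrow>
     is_functor (int_cat G) C d' \<and> is_nat_trans (int_cat G) C d d' \<alpha> \<and>
     (\<forall>x \<in> verts G. ob d' (Vertex x) \<in> (\<Union>n. \<Omega> n)) \<and>
     (\<forall>e \<in> edges G. ob d' (Edge e) = ob d (Edge e) \<and> \<alpha> (Edge e) = Id C (ob d (Edge e))) \<and>
     (\<forall>x \<in> verts G. monic C (\<alpha> (Vertex x)))"


section \<open>Width categories\<close>

locale sd_category = category C
  for C :: "('o, 'a) cat" (structure) and \<G> :: "('v, 'e, 'l) mgraph set" +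
  assumes shapes: "G \<in> \<G> \<Longrightarrow> multigraph G"
    and one_vertex: "\<exists>G \<in> \<G>. card (verts G) = 1 \<and> edges G = {}"
    and W1: "\<lbrakk>G \<in> \<G>; structured_decomposition C G d\<rbrakk> \<Longrightarrow> \<exists>x c. is_colimit (int_cat G) C d x c"

text \<open>
  A full subcategory is given by its set of objects, and the filtered subcategory \<open>\<Omega>\<close> by its
  filtration, so that the complete objects are those in \<open>\<Union>n. \<Omega> n\<close>.
\<close>

locale spined_sd_category = sd_category C \<G>
  for C :: "('o, 'a) cat" (structure) and \<G> :: "('v, 'e, 'l) mgraph set"
    and \<Omega> :: "nat \<Rightarrow> 'o set" +
  assumes spine_Obj: "\<Omega> n \<subseteq> Obj C"
    and spine_iso: "\<lbrakk>x \<in> \<Omega> n; isomorphic C x y\<rbrakk> \<Longrightarrow> y \<in> \<Omega> n"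
    and spine_Suc: "\<Omega> n \<subseteq> \<Omega> (Suc n)"
    and W2a: "x \<in> Obj C \<Longrightarrow> \<exists>w \<in> (\<Union>n. \<Omega> n). mono_hom C x w \<noteq> {}"
    and W2b: "\<lbrakk>n \<ge> 1; w \<in> \<Omega> n - \<Omega> (n - 1); z \<in> \<Omega> (n - 1)\<rbrakk> \<Longrightarrow> mono_hom C w z = {}"

locale width_category = spined_sd_category C \<G> \<Omega>
  for C :: "('o, 'a) cat" (structure) and \<G> :: "('v, 'e, 'l) mgraph set"
    and \<Omega> :: "nat \<Rightarrow> 'o set" +
  assumes monic_pullbacks:
      "\<lbrakk>monic C f; g \<in> Arr C; Cod C g = Cod C f\<rbrakk> \<Longrightarrow> \<exists>P p q. is_pullback C f g P p q"
    and W3_exists: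
      "\<lbrakk>G \<in> \<G>; structured_decomposition C G d; is_colimit (int_cat G) C d y c; f \<in> mono_hom C x y\<rbrakk>
        \<Longrightarrow> \<exists>d' c' \<pi>. is_pullback_cocone (int_cat G) C d c f d' c' \<pi>"
    and W3_colimit:
      "\<lbrakk>G \<in> \<G>; structured_decomposition C G d; is_colimit (int_cat G) C d y c; f \<in> mono_hom C x y;
        is_pullback_cocone (int_cat G) C d c f d' c' \<pi>\<rbrakk>
        \<Longrightarrow> is_colimit (int_cat G) C d' x c'"

locale complete_width_category = width_category C \<G> \<Omega>
  for C :: "('o, 'a) cat" (structure) and \<G> :: "('v, 'e, 'l) mgraph set"
    and \<Omega> :: "nat \<Rightarrow> 'o set" +
  assumes W4:
      "\<lbrakk>G \<in> \<G>; structured_decomposition C G d; is_completion C G \<Omega> d d' \<alpha>;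
        is_colimit (int_cat G) C d x c; is_colimit (int_cat G) C d' x' c';
        m \<in> hom C x x'; \<forall>i \<in> Obj (int_cat G). m \<odot> c i = c' i \<odot> \<alpha> i\<rbrakk>
        \<Longrightarrow> monic C m"


section \<open>Widths\<close>

text \<open>
  Widths are integers, since the value \<open>-1\<close> occurs.  The minima below are of non-empty sets
  (every object embeds in a complete one, has a decomposition over the one-vertex shape, and shapes
  are finite) that are bounded below by \<open>-1\<close>, so that \<^const>\<open>Least\<close> selects an actual minimum.
\<close>

definition obj_size :: "('o, 'a) cat \<Rightarrow> (nat \<Rightarrow> 'o set) \<Rightarrow> 'o \<Rightarrow> nat" where
  "obj_size C \<Omega> x = (LEAST n. \<exists>w \<in> \<Omega> n. mono_hom C x w \<noteq> {})"

definition decomp_width ::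
  "('o, 'a) cat \<Rightarrow> (nat \<Rightarrow> 'o set) \<Rightarrow> ('v, 'e, 'l) mgraph \<Rightarrow> ('v, 'e, 'l, 'o, 'a) decomp \<Rightarrow> int" where
  "decomp_width C \<Omega> G d =
     int (if verts G = {} then 0 else Max ((\<lambda>x. obj_size C \<Omega> (ob d (Vertex x))) ` verts G)) - 1"

definition gamma_width ::
  "('o, 'a) cat \<Rightarrow> ('v, 'e, 'l) mgraph set \<Rightarrow> (nat \<Rightarrow> 'o set) \<Rightarrow> 'o \<Rightarrow> int" where
  "gamma_width C \<G> \<Omega> x =
     (LEAST k. \<exists>G \<in> \<G>. \<exists>d. decomposition_of C G d x \<and> k = decomp_width C \<Omega> G d)"

definition complete_decomposition_of ::
  "('o, 'a) cat \<Rightarrow> (nat \<Rightarrow> 'o set) \<Rightarrow> ('v, 'e, 'l) mgraph \<Rightarrow> ('v, 'e, 'l, 'o, 'a) decomp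
    \<Rightarrow> 'o \<Rightarrow> bool" where
  "complete_decomposition_of C \<Omega> G d y \<longleftrightarrow> decomposition_of C G d y \<and>
     (\<forall>x \<in> verts G. ob d (Vertex x) \<in> (\<Union>n. \<Omega> n))"

definition complete_decomp_width ::
  "(nat \<Rightarrow> 'o set) \<Rightarrow> ('v, 'e, 'l) mgraph \<Rightarrow> ('v, 'e, 'l, 'o, 'a) decomp \<Rightarrow> int" where
  "complete_decomp_width \<Omega> G d = int (LEAST n. \<forall>x \<in> verts G. ob d (Vertex x) \<in> \<Omega> n) - 1"

definition chordal ::
  "('o, 'a) cat \<Rightarrow> ('v, 'e, 'l) mgraph set \<Rightarrow> (nat \<Rightarrow> 'o set) \<Rightarrow> 'o \<Rightarrow> bool" where
  "chordal C \<G> \<Omega> y \<longleftrightarrow> (\<exists>G \<in> \<G>. \<exists>d. complete_decomposition_of C \<Omega> G d y)"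

definition chordal_obj_width ::
  "('o, 'a) cat \<Rightarrow> ('v, 'e, 'l) mgraph set \<Rightarrow> (nat \<Rightarrow> 'o set) \<Rightarrow> 'o \<Rightarrow> int" where
  "chordal_obj_width C \<G> \<Omega> y =
     (LEAST k. \<exists>G \<in> \<G>. \<exists>d. complete_decomposition_of C \<Omega> G d y \<and> k = complete_decomp_width \<Omega> G d)"

definition chordal_gamma_width ::
  "('o, 'a) cat \<Rightarrow> ('v, 'e, 'l) mgraph set \<Rightarrow> (nat \<Rightarrow> 'o set) \<Rightarrow> 'o \<Rightarrow> int" where
  "chordal_gamma_width C \<G> \<Omega> x =
     (LEAST k. \<exists>y. chordal C \<G> \<Omega> y \<and> mono_hom C x y \<noteq> {} \<and> k = chordal_obj_width C \<G> \<Omega> y)"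

end

theory Submission
  imports Defs
begin

text \<open>
  A complete decomposition of \<open>Y\<close> pulls back along a monomorphism \<open>X \<hookrightarrow> Y\<close> to a decomposition of \<open>X\<close>
  whose bags embed in the old ones, which gives \<open>\<le>\<close>.  Conversely, enlarging every bag of a decomposition
  of \<open>X\<close> to a complete object of the same size, while keeping the adhesions, gives a complete
  decomposition, into whose colimit \<open>X\<close> embeds by (W4).
\<close>

section \<open>Minima of sets of integers bounded below\<close>

text \<open>The integers are not well-ordered, so \<open>LEAST\<close> is meaningful only with a
  lower bound \<open>b\<close>. Writing each element as \<open>b + int n\<close> moves the minimum
  to the natural numbers.\<close>

lemma Least_int_bounded:
  fixes P :: "int \<Rightarrow> bool"
  assumes "P k" and "\<And>j. P j \<Longrightarrow> b \<le> j"
  shows "P (LEAST j. P j)" and "(LEAST j. P j) \<le> k"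
proof -
  let ?Q = "\<lambda>n. P (b + int n)"
  have shift: "j = b + int (nat (j - b))" if "P j" for j
    using assms(2)[OF that] by simp
  have "?Q (nat (k - b))"
    using assms(1) shift by metis
  then have Q: "?Q (LEAST n. ?Q n)"
    by (rule LeastI)
  have le: "b + int (LEAST n. ?Q n) \<le> j" if "P j" for j
  proof -
    have "?Q (nat (j - b))"
      using that shift by metis
    then have "(LEAST n. ?Q n) \<le> nat (j - b)"
      by (rule Least_le)
    then show ?thesis
      using assms(2)[OF that] by linarith
  qed
  have eq: "(LEAST j. P j) = b + int (LEAST n. ?Q n)"
    using Q le by (rule Least_equality)
  show "P (LEAST j. P j)"
    using Q by (simp only: eq)
  show "(LEAST j. P j) \<le> k"
    using le[OF assms(1)] by (simp only: eq)
qed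

section \<open>Monomorphisms, isomorphisms and pullbacks\<close>

lemma homD: "f \<in> hom C x y \<Longrightarrow> f \<in> Arr C \<and> Dom C f = x \<and> Cod C f = y"
  by (simp add: hom_def)

context category
begin

lemma hom_Obj: "f \<in> hom C x y \<Longrightarrow> x \<in> Obj C \<and> y \<in> Obj C"
  using Dom_in Cod_in by (auto simp: hom_def)

lemma Id_hom: "x \<in> Obj C \<Longrightarrow> Id C x \<in> hom C x x"
  by (simp add: hom_def Id_in Dom_Id Cod_Id)

lemma comp_hom: "\<lbrakk>f \<in> hom C x y; g \<in> hom C y z\<rbrakk> \<Longrightarrow> g \<odot> f \<in> hom C x z"
  by (simp add: hom_def Comp_in Dom_Comp Cod_Comp)

lemma comp_assoc_hom:
  "\<lbrakk>f \<in> hom C w x; g \<in> hom C x y; h \<in> hom C y z\<rbrakk> \<Longrightarrow> (h \<odot> g) \<odot> f = h \<odot> (g \<odot> f)"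
  by (simp add: hom_def Comp_assoc)

lemma comp_Id_hom: "f \<in> hom C x y \<Longrightarrow> f \<odot> Id C x = f"
  using Comp_Id by (auto simp: hom_def)

lemma Id_comp_hom: "f \<in> hom C x y \<Longrightarrow> Id C y \<odot> f = f"
  using Id_Comp by (auto simp: hom_def)

lemma monicI:
  assumes "f \<in> hom C x y"
    and "\<And>w g h. \<lbrakk>w \<in> Obj C; g \<in> hom C w x; h \<in> hom C w x; f \<odot> g = f \<odot> h\<rbrakk> \<Longrightarrow> g = h"
  shows "monic C f"
  using assms by (auto simp: monic_def hom_def)

lemma monicD:
  assumes "monic C f" and "f \<in> hom C x y" and "g \<in> hom C w x" and "h \<in> hom C w x"
    and "f \<odot> g = f \<odot> h"
  shows "g = h"
  using assms hom_Obj[OF assms(3)] homD[OF assms(2)] unfolding monic_def by blast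

lemma monic_Id: "x \<in> Obj C \<Longrightarrow> monic C (Id C x)"
  by (rule monicI[OF Id_hom]) (auto simp: Id_comp_hom)

text \<open>Arrows identified by \<open>f\<close> are also identified by the composite. This gives
  monicity of arrows with a left inverse, and later of the arrows of a pulled-back
  decomposition.\<close>

lemma monic_if_comp_monic:
  assumes f: "f \<in> hom C x y" and g: "g \<in> hom C y z" and gf: "monic C (g \<odot> f)"
  shows "monic C f"
proof (rule monicI[OF f])
  fix w h k
  assume h: "h \<in> hom C w x" and k: "k \<in> hom C w x" and eq: "f \<odot> h = f \<odot> k"
  have "(g \<odot> f) \<odot> h = (g \<odot> f) \<odot> k"
    by (simp add: comp_assoc_hom[OF h f g] comp_assoc_hom[OF k f g] eq)
  then show "h = k"
    by (rule monicD[OF gf comp_hom[OF f g] h k])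
qed

lemma comp_mono_hom:
  assumes "f \<in> mono_hom C x y" and "g \<in> mono_hom C y z"
  shows "g \<odot> f \<in> mono_hom C x z"
proof -
  have f: "f \<in> hom C x y" "monic C f" and g: "g \<in> hom C y z" "monic C g"
    using assms by (auto simp: mono_hom_def)
  have "monic C (g \<odot> f)"
  proof (rule monicI[OF comp_hom[OF f(1) g(1)]])
    fix w h k
    assume h: "h \<in> hom C w x" and k: "k \<in> hom C w x" and "(g \<odot> f) \<odot> h = (g \<odot> f) \<odot> k"
    then have "g \<odot> (f \<odot> h) = g \<odot> (f \<odot> k)"
      by (simp add: comp_assoc_hom[OF h f(1) g(1)] comp_assoc_hom[OF k f(1) g(1)])
    then have "f \<odot> h = f \<odot> k"
      by (rule monicD[OF g(2,1) comp_hom[OF h f(1)] comp_hom[OF k f(1)]])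
    then show "h = k"
      by (rule monicD[OF f(2,1) h k])
  qed
  then show ?thesis
    using comp_hom[OF f(1) g(1)] by (simp add: mono_hom_def)
qed

lemma isomorphic_refl: "x \<in> Obj C \<Longrightarrow> isomorphic C x x"
  unfolding isomorphic_def using Id_hom comp_Id_hom by blast

lemma isomorphic_mono_hom:
  assumes "isomorphic C x y"
  shows "mono_hom C x y \<noteq> {}"
proof -
  obtain f g where x: "x \<in> Obj C" and f: "f \<in> hom C x y" and g: "g \<in> hom C y x" and "g \<odot> f = Id C x"
    using assms by (auto simp: isomorphic_def)
  then have "monic C f"
    using monic_if_comp_monic[OF f g] monic_Id[OF x] by simp
  then show ?thesis
    using f by (auto simp: mono_hom_def)
qed

text \<open>If \<open>q\<close> identifies \<open>h\<close> and \<open>k\<close>, commutativity of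
  the square and monicity of \<open>f\<close> make \<open>p\<close> identify them too. Both then
  solve the same universal problem and coincide by uniqueness.\<close>

lemma pullback_monic:
  assumes pb: "is_pullback C f g P p q" and mono: "monic C f"
  shows "monic C q"
proof -
  have f: "f \<in> hom C (Dom C f) (Cod C f)" and g: "g \<in> hom C (Dom C g) (Cod C f)"
    and p: "p \<in> hom C P (Dom C f)" and q: "q \<in> hom C P (Dom C g)" and sq: "f \<odot> p = g \<odot> q"
    using pb by (auto simp: is_pullback_def hom_def)
  show ?thesis
  proof (rule monicI[OF q])
    fix w h k
    assume w: "w \<in> Obj C" and h: "h \<in> hom C w P" and k: "k \<in> hom C w P" and eq: "q \<odot> h = q \<odot> k"
    have sqh: "f \<odot> (p \<odot> h) = g \<odot> (q \<odot> h)"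
      using comp_assoc_hom[OF h p f] comp_assoc_hom[OF h q g] sq by simp
    have sqk: "f \<odot> (p \<odot> k) = g \<odot> (q \<odot> k)"
      using comp_assoc_hom[OF k p f] comp_assoc_hom[OF k q g] sq by simp
    have "f \<odot> (p \<odot> h) = f \<odot> (p \<odot> k)"
      using sqh sqk eq by simp
    then have "p \<odot> h = p \<odot> k"
      by (rule monicD[OF mono f comp_hom[OF h p] comp_hom[OF k p]])
    moreover have "\<exists>!m. m \<in> hom C w P \<and> p \<odot> m = p \<odot> h \<and> q \<odot> m = q \<odot> h"
      using pb w comp_hom[OF h p] comp_hom[OF h q] sqh unfolding is_pullback_def by blast
    ultimately show "h = k"
      using h k eq by metis
  qed
qed

end

section \<open>Diagrams over the index category of a graph\<close>

lemma int_cat_simps [simp]: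
  "Obj (int_cat G) = Vertex ` verts G \<union> Edge ` edges G"
  "Arr (int_cat G) = Ident ` (Vertex ` verts G \<union> Edge ` edges G) \<union> Leg ` legs G"
  "Dom (int_cat G) (Ident i) = i"
  "Dom (int_cat G) (Leg l) = Edge (leg_edge G l)"
  "Cod (int_cat G) (Ident i) = i"
  "Cod (int_cat G) (Leg l) = Vertex (leg_vert G l)"
  "Id (int_cat G) = Ident"
  "Comp (int_cat G) (Ident i) u = u"
  "Comp (int_cat G) (Leg l) u = Leg l"
  by (simp_all add: int_cat_def)

text \<open>Every composable pair in \<open>int_cat G\<close> contains an identity, so compatibility
  with composition reduces to the unit laws of \<open>C\<close>, and only legs and identities have
  to be checked.\<close>

lemma (in category) is_functor_int_catI:
  assumes "multigraph G"
    and "\<And>i. i \<in> Obj (int_cat G) \<Longrightarrow> ob d i \<in> Obj C"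
    and "\<And>i. i \<in> Obj (int_cat G) \<Longrightarrow> ar d (Ident i) = Id C (ob d i)"
    and "\<And>l. l \<in> legs G \<Longrightarrow>
      ar d (Leg l) \<in> hom C (ob d (Edge (leg_edge G l))) (ob d (Vertex (leg_vert G l)))"
  shows "is_functor (int_cat G) C d"
proof -
  have "ar d u \<in> hom C (ob d (Dom (int_cat G) u)) (ob d (Cod (int_cat G) u))"
    if "u \<in> Arr (int_cat G)" for u
    using that assms Id_hom by (cases u) auto
  moreover have "ar d (Comp (int_cat G) v u) = ar d v \<odot> ar d u"
    if u: "u \<in> Arr (int_cat G)" and v: "v \<in> Arr (int_cat G)"
      and uv: "Cod (int_cat G) u = Dom (int_cat G) v" for u v
  proof (cases v)
    case (Ident i)
    then have "i \<in> Obj (int_cat G)" and "ar d u \<in> hom C (ob d (Dom (int_cat G) u)) (ob d i)"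
      using v calculation[OF u] uv by auto
    then show ?thesis
      using Ident assms(3) Id_comp_hom by simp
  next
    case (Leg l)
    \<comment> \<open>A leg starts at an edge object, whereas legs only end at vertex objects, so
      the arrow preceding \<open>Leg l\<close> must be an identity.\<close>
    then obtain i where i: "u = Ident i"
      using uv by (cases u) auto
    then have "ar d u = Id C (ob d (Edge (leg_edge G l)))" and "l \<in> legs G"
      using uv u v Leg assms(3) by auto
    then show ?thesis
      using Leg comp_Id_hom[OF assms(4)] by simp
  qed
  ultimately show ?thesis
    using assms(2,3) by (simp add: is_functor_def)
qed

text \<open>The index category has a single object here, so the constant diagram has
  \<open>x\<close> itself as colimit. This makes the minimum defining \<open>gamma_width\<close>
  range over a non-empty set.\<close>

lemma (in category) decomposition_of_one_vertex:
  assumes G: "multigraph G" and V: "verts G = {v}" and E: "edges G = {}" and x: "x \<in> Obj C"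
  shows "decomposition_of C G \<lparr>ob = \<lambda>_. x, ar = \<lambda>_. Id C x\<rparr> x" (is "decomposition_of C G ?d x")
proof -
  have L: "legs G = {}"
    using G E by (auto simp: multigraph_def)
  have "is_functor (int_cat G) C ?d"
    by (rule is_functor_int_catI[OF G]) (use x L in auto)
  then have "structured_decomposition C G ?d"
    by (simp add: structured_decomposition_def monic_Id[OF x])
  moreover have "is_colimit (int_cat G) C ?d x (\<lambda>_. Id C x)"
    unfolding is_colimit_def
  proof (intro conjI allI impI)
    show "is_cocone (int_cat G) C ?d x (\<lambda>_. Id C x)"
      using x Id_hom[OF x] comp_Id_hom[OF Id_hom[OF x]] by (simp add: is_cocone_def)
    fix y k
    assume "is_cocone (int_cat G) C ?d y k"
    \<comment> \<open>Since the colimit cocone consists of identities, the mediating arrow can only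
      be this component of \<open>k\<close>.\<close>
    then have "k (Vertex v) \<in> hom C x y"
      by (auto simp: is_cocone_def V)
    then show "\<exists>!m. m \<in> hom C x y \<and> (\<forall>i \<in> Obj (int_cat G). m \<odot> Id C x = k i)"
      by (auto simp: V E comp_Id_hom)
  qed
  ultimately show ?thesis
    using isomorphic_refl[OF x] by (auto simp: decomposition_of_def)
qed

section \<open>Bounds on widths and attainment of the minima\<close>

context spined_sd_category
begin

lemma spine_mono: "m \<le> n \<Longrightarrow> \<Omega> m \<subseteq> \<Omega> n"
  using spine_Suc by (rule lift_Suc_mono_le)

lemma obj_size_attained:
  assumes "x \<in> Obj C"
  shows "\<exists>w \<in> \<Omega> (obj_size C \<Omega> x). mono_hom C x w \<noteq> {}"
proof -
  obtain n where "\<exists>w \<in> \<Omega> n. mono_hom C x w \<noteq> {}"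
    using W2a[OF assms] by blast
  then show ?thesis
    unfolding obj_size_def by (rule LeastI)
qed

lemma obj_size_le: "\<lbrakk>w \<in> \<Omega> n; mono_hom C x w \<noteq> {}\<rbrakk> \<Longrightarrow> obj_size C \<Omega> x \<le> n"
  unfolding obj_size_def by (rule Least_le) blast

lemma decomp_width_le:
  assumes "finite (verts G)" and "\<And>v. v \<in> verts G \<Longrightarrow> obj_size C \<Omega> (ob d (Vertex v)) \<le> n"
  shows "decomp_width C \<Omega> G d \<le> int n - 1"
proof -
  have "Max ((\<lambda>v. obj_size C \<Omega> (ob d (Vertex v))) ` verts G) \<le> n" if "verts G \<noteq> {}"
    using assms that by simp
  then show ?thesis
    \<comment> \<open>Without vertices the width is -1, which is at most \<open>int n - 1\<close>
      for every natural \<open>n\<close>.\<close>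
    by (cases "verts G = {}") (simp_all add: decomp_width_def del: Max_le_iff)
qed

lemma complete_decomp_width_le:
  assumes "\<And>v. v \<in> verts G \<Longrightarrow> ob d (Vertex v) \<in> \<Omega> n"
  shows "complete_decomp_width \<Omega> G d \<le> int n - 1"
proof -
  have "(LEAST n. \<forall>v \<in> verts G. ob d (Vertex v) \<in> \<Omega> n) \<le> n"
    by (rule Least_le) (simp add: assms)
  then show ?thesis
    by (simp add: complete_decomp_width_def)
qed

text \<open>There are finitely many bags and the filtration is increasing, so some level contains
  all of them, and hence a least such level exists.\<close>

lemma complete_decomp_width_attained:
  assumes fin: "finite (verts G)" and "\<And>v. v \<in> verts G \<Longrightarrow> ob d (Vertex v) \<in> (\<Union>n. \<Omega> n)"
  obtains n where "\<And>v. v \<in> verts G \<Longrightarrow> ob d (Vertex v) \<in> \<Omega> n"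
    and "complete_decomp_width \<Omega> G d = int n - 1"
proof -
  have "\<forall>v \<in> verts G. \<exists>n. ob d (Vertex v) \<in> \<Omega> n"
    using assms(2) by blast
  then obtain N where N: "\<And>v. v \<in> verts G \<Longrightarrow> ob d (Vertex v) \<in> \<Omega> (N v)"
    by metis
  \<comment> \<open>The sum of the chosen levels is a common upper bound that also makes sense for
    an empty vertex set.\<close>
  have "N v \<le> (\<Sum>v \<in> verts G. N v)" if "v \<in> verts G" for v
    using that fin by (simp add: member_le_sum)
  then have "\<forall>v \<in> verts G. ob d (Vertex v) \<in> \<Omega> (\<Sum>v \<in> verts G. N v)"
    using N spine_mono by blast
  then have "\<forall>v \<in> verts G. ob d (Vertex v) \<in> \<Omega> (LEAST n. \<forall>v \<in> verts G. ob d (Vertex v) \<in> \<Omega> n)"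
    by (rule LeastI)
  then show thesis
    using that unfolding complete_decomp_width_def by blast
qed

lemma gamma_width_le:
  "\<lbrakk>G \<in> \<G>; decomposition_of C G d x\<rbrakk> \<Longrightarrow> gamma_width C \<G> \<Omega> x \<le> decomp_width C \<Omega> G d"
  unfolding gamma_width_def
  \<comment> \<open>The lower bound -1 holds because a width is a natural number minus one.\<close>
  by (rule Least_int_bounded(2)[where b = "-1"]) (auto simp: decomp_width_def)

lemma gamma_width_attained:
  assumes "x \<in> Obj C"
  obtains G d where "G \<in> \<G>" and "decomposition_of C G d x"
    and "gamma_width C \<G> \<Omega> x = decomp_width C \<Omega> G d"
proof -
  obtain G v where G: "G \<in> \<G>" and "verts G = {v}" "edges G = {}"
    using one_vertex by (auto simp: card_1_singleton_iff)
  then have "decomposition_of C G \<lparr>ob = \<lambda>_. x, ar = \<lambda>_. Id C x\<rparr> x"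
    using decomposition_of_one_vertex[OF shapes[OF G]] assms by blast
  then obtain k where "\<exists>G \<in> \<G>. \<exists>d. decomposition_of C G d x \<and> k = decomp_width C \<Omega> G d"
    using G by blast
  then have "\<exists>G \<in> \<G>. \<exists>d. decomposition_of C G d x \<and> gamma_width C \<G> \<Omega> x = decomp_width C \<Omega> G d"
    unfolding gamma_width_def
    by (rule Least_int_bounded(1)[where b = "-1"]) (auto simp: decomp_width_def)
  then show thesis
    using that by blast
qed

lemma chordal_obj_width_le:
  "\<lbrakk>G \<in> \<G>; complete_decomposition_of C \<Omega> G d y\<rbrakk>
    \<Longrightarrow> chordal_obj_width C \<G> \<Omega> y \<le> complete_decomp_width \<Omega> G d"
  unfolding chordal_obj_width_def
  by (rule Least_int_bounded(2)[where b = "-1"]) (auto simp: complete_decomp_width_def)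

lemma chordal_obj_width_attained:
  assumes "chordal C \<G> \<Omega> y"
  obtains G d where "G \<in> \<G>" and "complete_decomposition_of C \<Omega> G d y"
    and "chordal_obj_width C \<G> \<Omega> y = complete_decomp_width \<Omega> G d"
proof -
  obtain k where "\<exists>G \<in> \<G>. \<exists>d. complete_decomposition_of C \<Omega> G d y \<and> k = complete_decomp_width \<Omega> G d"
    using assms by (auto simp: chordal_def)
  then have "\<exists>G \<in> \<G>. \<exists>d. complete_decomposition_of C \<Omega> G d y \<and>
      chordal_obj_width C \<G> \<Omega> y = complete_decomp_width \<Omega> G d"
    unfolding chordal_obj_width_def
    by (rule Least_int_bounded(1)[where b = "-1"]) (auto simp: complete_decomp_width_def)
  then show thesis
    using that by blast
qed

text \<open>Supplies the lower bound for the outer minimum, the one over chordal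
  completions.\<close>

lemma chordal_obj_width_ge: "chordal C \<G> \<Omega> y \<Longrightarrow> -1 \<le> chordal_obj_width C \<G> \<Omega> y"
  by (erule chordal_obj_width_attained) (simp add: complete_decomp_width_def)

lemma chordal_gamma_width_le:
  assumes "chordal C \<G> \<Omega> y" and "mono_hom C x y \<noteq> {}"
  shows "chordal_gamma_width C \<G> \<Omega> x \<le> chordal_obj_width C \<G> \<Omega> y"
  unfolding chordal_gamma_width_def
  by (rule Least_int_bounded(2)[where b = "-1"]) (use assms chordal_obj_width_ge in auto)

text \<open>The completion \<open>z\<close> only witnesses that the set being minimised is
  non-empty; the minimiser \<open>y\<close> may be a different object.\<close>

lemma chordal_gamma_width_attained:
  assumes "chordal C \<G> \<Omega> z" and "mono_hom C x z \<noteq> {}"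
  obtains y where "chordal C \<G> \<Omega> y" and "mono_hom C x y \<noteq> {}"
    and "chordal_gamma_width C \<G> \<Omega> x = chordal_obj_width C \<G> \<Omega> y"
proof -
  have "\<exists>y. chordal C \<G> \<Omega> y \<and> mono_hom C x y \<noteq> {} \<and>
      chordal_gamma_width C \<G> \<Omega> x = chordal_obj_width C \<G> \<Omega> y"
    unfolding chordal_gamma_width_def
    by (rule Least_int_bounded(1)[where b = "-1" and k = "chordal_obj_width C \<G> \<Omega> z"])
      (use assms chordal_obj_width_ge in auto)
  then show thesis
    using that by blast
qed

end

section \<open>Pulling a complete decomposition back along a monomorphism\<close>

text \<open>By (W3) the pullback of the colimit cocone of \<open>d\<close> is a colimit cocone over
  \<open>x\<close>. Its bags embed in those of \<open>d\<close>, so their sizes do not exceed the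
  level containing the bags of \<open>d\<close>.\<close>

lemma (in width_category) gamma_width_le_complete_decomp_width:
  assumes G: "G \<in> \<G>" and d: "complete_decomposition_of C \<Omega> G d y" and xy: "mono_hom C x y \<noteq> {}"
  shows "gamma_width C \<G> \<Omega> x \<le> complete_decomp_width \<Omega> G d"
proof -
  have fin: "finite (verts G)"
    using shapes[OF G] by (simp add: multigraph_def)
  obtain z c where sd: "structured_decomposition C G d" and colim: "is_colimit (int_cat G) C d z c"
    and yz: "isomorphic C y z"
    using d by (auto simp: complete_decomposition_of_def decomposition_of_def)
  \<comment> \<open>A decomposition of \<open>y\<close> has a colimit \<open>z\<close> that is only
    isomorphic to \<open>y\<close>, so the embedding of \<open>x\<close> is first transported to
    \<open>z\<close>.\<close>
  obtain f where f: "f \<in> mono_hom C x z"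
    using xy isomorphic_mono_hom[OF yz] comp_mono_hom by blast
  then have mono_f: "monic C f" and x: "x \<in> Obj C"
    using hom_Obj by (auto simp: mono_hom_def)
  obtain d' c' \<pi> where pbc: "is_pullback_cocone (int_cat G) C d c f d' c' \<pi>"
    using W3_exists[OF G sd colim f] by blast
  have colim': "is_colimit (int_cat G) C d' x c'"
    by (rule W3_colimit[OF G sd colim f pbc])
  have func: "is_functor (int_cat G) C d'" and nat: "is_nat_trans (int_cat G) C d' d \<pi>"
    and pb: "\<And>i. i \<in> Obj (int_cat G) \<Longrightarrow> is_pullback C f (c i) (ob d' i) (c' i) (\<pi> i)"
    using pbc by (auto simp: is_pullback_cocone_def)
  have pi: "\<pi> i \<in> mono_hom C (ob d' i) (ob d i)" if "i \<in> Obj (int_cat G)" for i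
    using nat that pullback_monic[OF pb mono_f] unfolding is_nat_trans_def mono_hom_def by blast
  \<comment> \<open>A pullback cocone is only required to be over a functor, so monicity of its
    arrows has to be proved. By naturality \<open>\<pi> ?j \<odot> ar d' u\<close> equals a
    composite of two monomorphisms, so its first factor is monic.\<close>
  have "monic C (ar d' u)" if u: "u \<in> Arr (int_cat G)" for u
  proof -
    let ?i = "Dom (int_cat G) u" and ?j = "Cod (int_cat G) u"
    interpret J: category "int_cat G"
      using shapes[OF G] by (rule category_int_cat)
    have i: "?i \<in> Obj (int_cat G)" and j: "?j \<in> Obj (int_cat G)"
      using J.Dom_in[OF u] J.Cod_in[OF u] .
    have "ar d u \<in> mono_hom C (ob d ?i) (ob d ?j)"
      using sd u by (auto simp: structured_decomposition_def is_functor_def mono_hom_def simp del: int_cat_simps)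
    then have "ar d u \<odot> \<pi> ?i \<in> mono_hom C (ob d' ?i) (ob d ?j)"
      by (rule comp_mono_hom[OF pi[OF i]])
    moreover have "ar d u \<odot> \<pi> ?i = \<pi> ?j \<odot> ar d' u"
      using nat u by (auto simp: is_nat_trans_def simp del: int_cat_simps)
    ultimately have "monic C (\<pi> ?j \<odot> ar d' u)"
      by (simp add: mono_hom_def)
    moreover have "ar d' u \<in> hom C (ob d' ?i) (ob d' ?j)"
      using func u by (auto simp: is_functor_def simp del: int_cat_simps)
    moreover have "\<pi> ?j \<in> hom C (ob d' ?j) (ob d ?j)"
      using pi[OF j] by (simp add: mono_hom_def)
    ultimately show ?thesis
      using monic_if_comp_monic by blast
  qed
  then have "decomposition_of C G d' x"
    using func colim' isomorphic_refl[OF x]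
    by (auto simp: decomposition_of_def structured_decomposition_def simp del: int_cat_simps)
  then have le: "gamma_width C \<G> \<Omega> x \<le> decomp_width C \<Omega> G d'"
    by (rule gamma_width_le[OF G])
  obtain n where n: "\<And>v. v \<in> verts G \<Longrightarrow> ob d (Vertex v) \<in> \<Omega> n"
    and width: "complete_decomp_width \<Omega> G d = int n - 1"
    using complete_decomp_width_attained[OF fin, of d] d
    by (auto simp: complete_decomposition_of_def)
  have "decomp_width C \<Omega> G d' \<le> int n - 1"
  proof (rule decomp_width_le[OF fin])
    fix v
    assume v: "v \<in> verts G"
    then have "mono_hom C (ob d' (Vertex v)) (ob d (Vertex v)) \<noteq> {}"
      using pi[of "Vertex v"] by auto
    then show "obj_size C \<Omega> (ob d' (Vertex v)) \<le> n"
      by (rule obj_size_le[OF n[OF v]])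
  qed
  then show ?thesis
    using le width by simp
qed

section \<open>Enlarging bags to complete objects\<close>

text \<open>Intended for monomorphisms \<open>m v\<close> from the bag at \<open>v\<close> into a
  complete object \<open>W v\<close>. Adhesions stay fixed, as a completion demands; identities are
  set separately because the bags they belong to have changed.\<close>

definition enlarge_bags ::
  "('o, 'a) cat \<Rightarrow> ('v, 'e, 'l) mgraph \<Rightarrow> ('v, 'e, 'l, 'o, 'a) decomp \<Rightarrow> ('v \<Rightarrow> 'o) \<Rightarrow> ('v \<Rightarrow> 'a)
    \<Rightarrow> ('v, 'e, 'l, 'o, 'a) decomp" where
  "enlarge_bags C G d W m =
    \<lparr>ob = (\<lambda>i. case i of Vertex v \<Rightarrow> W v | Edge e \<Rightarrow> ob d (Edge e)),
     ar = (\<lambda>u. case u of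
         Ident i \<Rightarrow> Id C (case i of Vertex v \<Rightarrow> W v | Edge e \<Rightarrow> ob d (Edge e))
       | Leg l \<Rightarrow> m (leg_vert G l) \<odot>\<^bsub>C\<^esub> ar d (Leg l))\<rparr>"

text \<open>The new legs are composites of two monomorphisms, an old leg and the embedding of its
  bag. These embeddings, together with identities on the adhesions, form the completion.\<close>

lemma (in category) enlarge_bags:
  fixes d :: "('v, 'e, 'l, 'o, 'a) decomp" and \<Omega> :: "nat \<Rightarrow> 'o set"
  assumes G: "multigraph G" and d: "structured_decomposition C G d"
    and m: "\<And>v. v \<in> verts G \<Longrightarrow> m v \<in> mono_hom C (ob d (Vertex v)) (W v)"
    and W: "\<And>v. v \<in> verts G \<Longrightarrow> W v \<in> (\<Union>n. \<Omega> n)"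
  shows "structured_decomposition C G (enlarge_bags C G d W m)" (is "structured_decomposition C G ?d'")
    and "is_completion C G \<Omega> d (enlarge_bags C G d W m)
      (\<lambda>i. case i of Vertex v \<Rightarrow> m v | Edge e \<Rightarrow> Id C (ob d (Edge e)))" (is "is_completion C G \<Omega> d _ ?\<alpha>")
proof -
  have ends: "leg_edge G l \<in> edges G" "leg_vert G l \<in> verts G" if "l \<in> legs G" for l
    using G that by (auto simp: multigraph_def)
  have func: "is_functor (int_cat G) C d"
    using d by (simp add: structured_decomposition_def)
  have obd: "ob d i \<in> Obj C" and idd: "ar d (Ident i) = Id C (ob d i)" if "i \<in> Obj (int_cat G)" for i
    using func that by (auto simp: is_functor_def)
  have leg: "ar d (Leg l) \<in> mono_hom C (ob d (Edge (leg_edge G l))) (ob d (Vertex (leg_vert G l)))"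
    if "l \<in> legs G" for l
  proof -
    have "Leg l \<in> Arr (int_cat G)"
      using that by simp
    then have "ar d (Leg l) \<in> hom C (ob d (Dom (int_cat G) (Leg l))) (ob d (Cod (int_cat G) (Leg l)))"
      and "monic C (ar d (Leg l))"
      using d unfolding structured_decomposition_def is_functor_def by blast+
    then show ?thesis
      by (simp add: mono_hom_def)
  qed
  have mh: "m v \<in> hom C (ob d (Vertex v)) (W v)" "monic C (m v)" if "v \<in> verts G" for v
    using m[OF that] by (auto simp: mono_hom_def)
  have ob': "ob ?d' i \<in> Obj C" if "i \<in> Obj (int_cat G)" for i
    using that obd hom_Obj[OF mh(1)] by (auto simp: enlarge_bags_def)
  have leg': "ar ?d' (Leg l) \<in> mono_hom C (ob ?d' (Edge (leg_edge G l))) (ob ?d' (Vertex (leg_vert G l)))"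
    if "l \<in> legs G" for l
    using comp_mono_hom[OF leg[OF that] m[OF ends(2)[OF that]]] by (simp add: enlarge_bags_def)
  have id': "ar ?d' (Ident i) = Id C (ob ?d' i)" for i
    by (simp add: enlarge_bags_def)
  have func': "is_functor (int_cat G) C ?d'"
    by (rule is_functor_int_catI[OF G ob' id']) (use leg' in \<open>auto simp: mono_hom_def\<close>)
  show "structured_decomposition C G ?d'"
    using func' ob' id' leg' monic_Id by (auto simp: structured_decomposition_def mono_hom_def)
  have \<alpha>: "?\<alpha> i \<in> hom C (ob d i) (ob ?d' i)" if "i \<in> Obj (int_cat G)" for i
    using that mh(1) Id_hom obd by (auto simp: enlarge_bags_def)
  have nat: "ar ?d' u \<odot> ?\<alpha> (Dom (int_cat G) u) = ?\<alpha> (Cod (int_cat G) u) \<odot> ar d u"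
    if "u \<in> Arr (int_cat G)" for u
  proof (cases u)
    case (Ident i)
    then have "i \<in> Obj (int_cat G)"
      using that by auto
    then show ?thesis
      using Ident id' idd comp_Id_hom[OF \<alpha>] Id_comp_hom[OF \<alpha>] by simp
  next
    case (Leg l)
    then have "l \<in> legs G"
      using that by auto
    then have "ar ?d' (Leg l) \<in> hom C (ob d (Edge (leg_edge G l))) (ob ?d' (Vertex (leg_vert G l)))"
      using leg' by (auto simp: mono_hom_def enlarge_bags_def)
    \<comment> \<open>At a leg, the transformation is the identity on the edge side and
      \<open>m\<close> on the vertex side, so the naturality square is the definition of the new
      leg.\<close>
    then have "ar ?d' (Leg l) \<odot> Id C (ob d (Edge (leg_edge G l))) = ar ?d' (Leg l)"
      by (rule comp_Id_hom)
    then show ?thesis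
      using Leg by (simp add: enlarge_bags_def)
  qed
  have "is_nat_trans (int_cat G) C d ?d' ?\<alpha>"
    using \<alpha> nat unfolding is_nat_trans_def by blast
  then show "is_completion C G \<Omega> d ?d' ?\<alpha>"
    using func' W mh(2) unfolding is_completion_def by (simp add: enlarge_bags_def)
qed

text \<open>Restricting a cocone along a natural transformation yields the cocone that induces the
  comparison map between the two colimits.\<close>

lemma (in category) is_cocone_nat_trans:
  assumes J: "category J" and d: "is_functor J C d" and d': "is_functor J C d'"
    and \<alpha>: "is_nat_trans J C d d' \<alpha>" and c: "is_cocone J C d' x c"
  shows "is_cocone J C d x (\<lambda>i. c i \<odot> \<alpha> i)"
proof -
  interpret J: category J
    by (rule J)
  have ah: "\<alpha> i \<in> hom C (ob d i) (ob d' i)" and ch: "c i \<in> hom C (ob d' i) x" if "i \<in> Obj J" for i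
    using \<alpha> c that by (auto simp: is_nat_trans_def is_cocone_def)
  have "(c (Cod J u) \<odot> \<alpha> (Cod J u)) \<odot> ar d u = c (Dom J u) \<odot> \<alpha> (Dom J u)" if u: "u \<in> Arr J" for u
  proof -
    note i = J.Dom_in[OF u] and j = J.Cod_in[OF u]
    have du: "ar d u \<in> hom C (ob d (Dom J u)) (ob d (Cod J u))"
      and du': "ar d' u \<in> hom C (ob d' (Dom J u)) (ob d' (Cod J u))"
      using d d' u by (auto simp: is_functor_def)
    have "(c (Cod J u) \<odot> \<alpha> (Cod J u)) \<odot> ar d u = c (Cod J u) \<odot> (ar d' u \<odot> \<alpha> (Dom J u))"
      using comp_assoc_hom[OF du ah[OF j] ch[OF j]] \<alpha> u by (simp add: is_nat_trans_def)
    also have "\<dots> = c (Dom J u) \<odot> \<alpha> (Dom J u)"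
      using comp_assoc_hom[OF ah[OF i] du' ch[OF j]] c u by (simp add: is_cocone_def)
    finally show ?thesis .
  qed
  then show ?thesis
    using c comp_hom[OF ah ch] by (simp add: is_cocone_def)
qed

text \<open>The enlarged decomposition has a colimit \<open>y\<close> by (W1), which is therefore
  chordal, and (W4) makes the comparison map into \<open>y\<close> monic.\<close>

lemma (in complete_width_category) chordal_completion_of_decomposition:
  assumes G: "G \<in> \<G>" and d: "decomposition_of C G d x"
  obtains y where "chordal C \<G> \<Omega> y" and "mono_hom C x y \<noteq> {}"
    and "chordal_obj_width C \<G> \<Omega> y \<le> decomp_width C \<Omega> G d"
proof -
  have mg: "multigraph G"
    using shapes[OF G] .
  obtain z c where sd: "structured_decomposition C G d" and colim: "is_colimit (int_cat G) C d z c"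
    and xz: "isomorphic C x z"
    using d by (auto simp: decomposition_of_def)
  have func: "is_functor (int_cat G) C d"
    using sd by (simp add: structured_decomposition_def)
  \<comment> \<open>Each complete object is taken at the level given by the size of its bag, so that
    enlarging does not increase the width.\<close>
  have "\<forall>v \<in> verts G. \<exists>w f. w \<in> \<Omega> (obj_size C \<Omega> (ob d (Vertex v))) \<and> f \<in> mono_hom C (ob d (Vertex v)) w"
    using func obj_size_attained by (fastforce simp: is_functor_def)
  then obtain W m where W: "\<And>v. v \<in> verts G \<Longrightarrow> W v \<in> \<Omega> (obj_size C \<Omega> (ob d (Vertex v)))"
    and m: "\<And>v. v \<in> verts G \<Longrightarrow> m v \<in> mono_hom C (ob d (Vertex v)) (W v)"
    by metis
  define d' where "d' = enlarge_bags C G d W m"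
  obtain \<alpha> where sd': "structured_decomposition C G d'" and compl: "is_completion C G \<Omega> d d' \<alpha>"
    using enlarge_bags[OF mg sd m, of \<Omega>] W unfolding d'_def by blast
  obtain y c' where colim': "is_colimit (int_cat G) C d' y c'"
    using W1[OF G sd'] by blast
  have y: "y \<in> Obj C"
    using colim' by (simp add: is_colimit_def is_cocone_def)
  have "is_cocone (int_cat G) C d y (\<lambda>i. c' i \<odot> \<alpha> i)"
  proof (rule is_cocone_nat_trans[OF category_int_cat[OF mg] func])
    show "is_functor (int_cat G) C d'" and "is_nat_trans (int_cat G) C d d' \<alpha>"
      using compl by (simp_all add: is_completion_def)
    show "is_cocone (int_cat G) C d' y c'"
      using colim' by (simp add: is_colimit_def)
  qed
  then obtain k where k: "k \<in> hom C z y" "\<forall>i \<in> Obj (int_cat G). k \<odot> c i = c' i \<odot> \<alpha> i"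
    using colim unfolding is_colimit_def by blast
  have "monic C k"
    by (rule W4[OF G sd compl colim colim' k])
  then have emb: "mono_hom C x y \<noteq> {}"
    using k(1) isomorphic_mono_hom[OF xz] comp_mono_hom unfolding mono_hom_def by blast
  have bags: "ob d' (Vertex v) = W v" for v
    by (simp add: d'_def enlarge_bags_def)
  have cd: "complete_decomposition_of C \<Omega> G d' y"
    using sd' colim' isomorphic_refl[OF y] W bags
    by (auto simp: complete_decomposition_of_def decomposition_of_def)
  \<comment> \<open>This is the width of \<open>d\<close> plus one, with the same default 0 for an
    empty vertex set. Monotonicity of the filtration puts all enlarged bags in this level.\<close>
  let ?n = "if verts G = {} then 0 else Max ((\<lambda>v. obj_size C \<Omega> (ob d (Vertex v))) ` verts G)"
  have "ob d' (Vertex v) \<in> \<Omega> ?n" if v: "v \<in> verts G" for v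
  proof -
    have "obj_size C \<Omega> (ob d (Vertex v)) \<le> ?n"
      using v mg by (auto simp: multigraph_def)
    then show ?thesis
      unfolding bags using W[OF v] spine_mono by blast
  qed
  then have "complete_decomp_width \<Omega> G d' \<le> decomp_width C \<Omega> G d"
    using complete_decomp_width_le[of G d' ?n] by (simp only: decomp_width_def)
  then have "chordal_obj_width C \<G> \<Omega> y \<le> decomp_width C \<Omega> G d"
    using chordal_obj_width_le[OF G cd] by linarith
  moreover have "chordal C \<G> \<Omega> y"
    using G cd by (auto simp: chordal_def)
  ultimately show thesis
    using that emb by blast
qed

theorem theorem2p6p7:
  fixes C :: "('o, 'a) cat"
    and \<G> :: "('v, 'e, 'l) mgraph set"
    and \<Omega> :: "nat \<Rightarrow> 'o set"
  assumes "complete_width_category C \<G> \<Omega>"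
    and "X \<in> Obj C"
  shows "gamma_width C \<G> \<Omega> X = chordal_gamma_width C \<G> \<Omega> X"
proof -
  interpret complete_width_category C \<G> \<Omega>
    by (rule assms(1))
  obtain G d where G: "G \<in> \<G>" and d: "decomposition_of C G d X"
    and w: "gamma_width C \<G> \<Omega> X = decomp_width C \<Omega> G d"
    using gamma_width_attained[OF assms(2)] .
  \<comment> \<open>Built from an optimal decomposition, \<open>z\<close> both ensures that the
    chordal minimum is attained and bounds it by the width of \<open>X\<close>.\<close>
  obtain z where z: "chordal C \<G> \<Omega> z" "mono_hom C X z \<noteq> {}"
    and zw: "chordal_obj_width C \<G> \<Omega> z \<le> decomp_width C \<Omega> G d"
    using chordal_completion_of_decomposition[OF G d] .
  obtain y where y: "chordal C \<G> \<Omega> y" and Xy: "mono_hom C X y \<noteq> {}"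
    and cw: "chordal_gamma_width C \<G> \<Omega> X = chordal_obj_width C \<G> \<Omega> y"
    using chordal_gamma_width_attained[OF z] .
  obtain H b where "H \<in> \<G>" and "complete_decomposition_of C \<Omega> H b y"
    and "chordal_obj_width C \<G> \<Omega> y = complete_decomp_width \<Omega> H b"
    using chordal_obj_width_attained[OF y] .
  then have "gamma_width C \<G> \<Omega> X \<le> chordal_gamma_width C \<G> \<Omega> X"
    using gamma_width_le_complete_decomp_width Xy cw by simp
  moreover have "chordal_gamma_width C \<G> \<Omega> X \<le> gamma_width C \<G> \<Omega> X"
    using chordal_gamma_width_le[OF z] zw w by simp
  ultimately show ?thesis
    by simp
qed

end
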